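(* Let $\beta_0,\beta_\omega\in(-\infty,+\infty]$ and, for every $L>0$, let $\sigma_1[-D^2,\beta_0,\beta_\omega,(0,L)]$ denote the principal eigenvalue of $$-u''=\sigma u\ \text{ in } [0,L],\qquad -u'(0)+\beta_0u(0)=0,\qquad u'(L)+\beta_\omega u(L)=0,$$ where the boundary condition at $0$ (resp. at $L$) is understood as $u(0)=0$ (resp. $u(L)=0$) if $\beta_0=+\infty$ (resp. $\beta_\omega=+\infty$). Then: (a) If $\beta_0+\beta_\omega>0$, then $\displaystyle\lim_{L\downarrow 0}\sigma_1[-D^2,\beta_0,\beta_\omega,(0,L)]=+\infty$. (b) If $\beta_0+\beta_\omega=0$, then $\sigma_1[-D^2,\beta_0,\beta_\omega,(0,L)]=-\beta_0^2\le 0$ for all $L>0$. (c) If $\beta_0+\beta_\omega<0$, then $\displaystyle\lim_{L\downarrow 0}\sigma_1[-D^2,\beta_0,\beta_\omega,(0,L)]=-\infty$.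
   Context: The constants $\beta_0,\beta_\omega$ are fixed (independent of $L$) and may have any sign. The value $+\infty$ encodes a homogeneous Dirichlet condition at the corresponding endpoint, and the value $0$ a Neumann condition; $\beta_0+\beta_\omega=+\infty>0$ if at least one of them is $+\infty$. The principal eigenvalue $\sigma_1[-D^2,\beta_0,\beta_\omega,(0,L)]$ is the unique real number $\sigma$ for which the boundary value problem admits an eigenfunction $u$ (smooth on $[0,L]$) with $u(x)>0$ for all $x\in(0,L)$; it is known that it exists, and it is the smallest eigenvalue. *)

theory Defs
  imports "HOL-Analysis.Analysis"
begin

text \<open>Derivatives are taken relative to \<open>[0,L]\<close>, hence one-sided at the two endpoints; they
  only depend on the values of \<open>u\<close> on \<open>[0,L]\<close>.\<close>

definition deriv_on :: "real \<Rightarrow> (real \<Rightarrow> real) \<Rightarrow> real \<Rightarrow> real" where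
  "deriv_on L u = (\<lambda>x. vector_derivative u (at x within {0..L}))"

definition smooth_on_interval :: "real \<Rightarrow> (real \<Rightarrow> real) \<Rightarrow> bool" where
  "smooth_on_interval L u \<longleftrightarrow> (\<forall>n. ((deriv_on L ^^ n) u) differentiable_on {0..L})"

text \<open>\<open>\<nu>\<close> is the outward normal derivative of \<open>u\<close> at an endpoint and \<open>v\<close> the value of \<open>u\<close>
  there; \<open>\<beta> = \<infinity>\<close> encodes the Dirichlet condition.\<close>

definition boundary_condition :: "ereal \<Rightarrow> real \<Rightarrow> real \<Rightarrow> bool" where
  "boundary_condition \<beta> \<nu> v \<longleftrightarrow> (if \<beta> = \<infinity> then v = 0 else \<nu> + real_of_ereal \<beta> * v = 0)"

definition solves_bvp :: "ereal \<Rightarrow> ereal \<Rightarrow> real \<Rightarrow> real \<Rightarrow> (real \<Rightarrow> real) \<Rightarrow> bool" where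
  "solves_bvp \<beta>\<^sub>0 \<beta>\<^sub>\<omega> L \<sigma> u \<longleftrightarrow>
     smooth_on_interval L u \<and>
     (\<forall>x\<in>{0..L}. - (deriv_on L (deriv_on L u) x) = \<sigma> * u x) \<and>
     boundary_condition \<beta>\<^sub>0 (- deriv_on L u 0) (u 0) \<and>
     boundary_condition \<beta>\<^sub>\<omega> (deriv_on L u L) (u L)"

definition principal_eigenvalue :: "ereal \<Rightarrow> ereal \<Rightarrow> real \<Rightarrow> real" where
  "principal_eigenvalue \<beta>\<^sub>0 \<beta>\<^sub>\<omega> L =
     (THE \<sigma>. \<exists>u. solves_bvp \<beta>\<^sub>0 \<beta>\<^sub>\<omega> L \<sigma> u \<and> (\<forall>x\<in>{0<..<L}. u x > 0))"

end

theory Submission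
  imports Defs "HOL-Real_Asymp.Real_Asymp"
begin

text \<open>
  A real number is the principal eigenvalue as soon as \<^emph>\<open>some\<close> eigenfunction belonging to it is
  positive on \<open>(0,L)\<close>, because two positive eigenfunctions \<open>u\<close>, \<open>v\<close> with eigenvalues \<open>\<sigma>\<close>, \<open>\<tau>\<close>
  force \<open>\<sigma> = \<tau>\<close>: their Wronskian \<open>u' v - u v'\<close> vanishes at both endpoints, while its
  derivative \<open>(\<tau> - \<sigma>) u v\<close> would otherwise have a strict sign inside (\<open>solves_bvp_unique\<close>).
  So it suffices to exhibit positive eigenfunctions, and each sign of \<open>\<beta>\<^sub>0 + \<beta>\<^sub>\<omega>\<close> has its own kind.

  If the sum is zero, \<open>exp (\<beta>\<^sub>0 x)\<close> satisfies both boundary conditions, for every \<open>L\<close>.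

  If the sum is positive, look for \<open>u x = cos (k x - a)\<close> with \<open>k > 0\<close>.  The boundary conditions
  and positivity hold when \<open>a\<close> and \<open>k L - a\<close> are the angles \<open>arctan (\<beta>\<^sub>0 / k)\<close> and
  \<open>arctan (\<beta>\<^sub>\<omega> / k)\<close> (with \<open>\<pi>/2\<close> for \<open>\<beta> = \<infinity>\<close>), which leaves the single equation
  \[ k L = \arctan (\beta_0/k) + \arctan (\beta_\omega/k). \]
  At any prescribed \<open>k = K\<close> the right-hand side is positive and independent of \<open>L\<close>, hence exceeds
  \<open>K L\<close> when \<open>L\<close> is small; since it is bounded by \<open>\<pi>\<close>, the left-hand side wins for large \<open>k\<close>.
  The intermediate value theorem gives a root \<open>k \<ge> K\<close>, so \<open>\<sigma> = k\<^sup>2 \<ge> K\<^sup>2\<close> with \<open>K\<close> arbitrary.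

  If the sum is negative, the same argument works with \<open>\<sigma> = - k\<^sup>2\<close> and a positive combination
  of \<open>exp (k x)\<close> and \<open>exp (- k x)\<close>; the characteristic equation becomes
  \[ (k - \beta_0)(k - \beta_\omega) = (k + \beta_0)(k + \beta_\omega)\, e^{2 k L}. \]
\<close>

section \<open>Uniqueness of the principal eigenvalue\<close>

lemma solves_bvp_has_derivs:
  assumes "solves_bvp \<beta>\<^sub>0 \<beta>\<^sub>\<omega> L \<sigma> u" "x \<in> {0..L}"
  shows "(u has_real_derivative deriv_on L u x) (at x within {0..L})"
    and "(deriv_on L u has_real_derivative - (\<sigma> * u x)) (at x within {0..L})"
proof -
  have "((deriv_on L ^^ n) u) differentiable (at x within {0..L})" for n
    using assms by (auto simp: solves_bvp_def smooth_on_interval_def differentiable_on_def)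
  from this[of 0] this[of 1] have *: "u differentiable (at x within {0..L})"
    "deriv_on L u differentiable (at x within {0..L})"
    by simp_all
  have eq: "- (\<sigma> * u x) = deriv_on L (deriv_on L u) x"
    using assms by (simp add: solves_bvp_def minus_equation_iff)
  show "(u has_real_derivative deriv_on L u x) (at x within {0..L})"
    using *(1) vector_derivative_works
    by (auto simp: has_real_derivative_iff_has_vector_derivative deriv_on_def)
  show "(deriv_on L u has_real_derivative - (\<sigma> * u x)) (at x within {0..L})"
    using *(2) vector_derivative_works unfolding eq
    by (auto simp: has_real_derivative_iff_has_vector_derivative deriv_on_def)
qed

text \<open>A boundary condition confines the pair \<open>(\<nu>, v)\<close> to a line through the origin, so any two
  admissible pairs are linearly dependent.\<close>

lemma boundary_condition_wronskian_zero:
  assumes "boundary_condition \<beta> \<nu> v" "boundary_condition \<beta> \<nu>' v'"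
  shows "\<nu> * v' - v * \<nu>' = 0"
proof (cases "\<beta> = \<infinity>")
  case False
  then have "\<nu> = - real_of_ereal \<beta> * v" "\<nu>' = - real_of_ereal \<beta> * v'"
    using assms by (auto simp: boundary_condition_def)
  then show ?thesis by simp
qed (use assms in \<open>auto simp: boundary_condition_def\<close>)

text \<open>The mean value theorem for the Wronskian replaces the usual integration by parts: equal
  (zero) endpoint values give an interior zero of its derivative \<open>(\<tau> - \<sigma>) u v\<close>.\<close>

lemma solves_bvp_unique:
  assumes "L > 0"
    and u: "solves_bvp \<beta>\<^sub>0 \<beta>\<^sub>\<omega> L \<sigma> u" "\<forall>x\<in>{0<..<L}. u x > 0"
    and v: "solves_bvp \<beta>\<^sub>0 \<beta>\<^sub>\<omega> L \<tau> v" "\<forall>x\<in>{0<..<L}. v x > 0"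
  shows "\<sigma> = \<tau>"
proof -
  define w where "w x = deriv_on L u x * v x - u x * deriv_on L v x" for x
  have "(w has_real_derivative (\<tau> - \<sigma>) * u x * v x) (at x within {0..L})" if "x \<in> {0..L}" for x
    unfolding w_def
    by (rule derivative_eq_intros solves_bvp_has_derivs[OF u(1) that]
          solves_bvp_has_derivs[OF v(1) that] refl)+ (simp add: algebra_simps)
  then obtain \<xi> where \<xi>: "\<xi> \<in> {0<..<L}" "w L - w 0 = (\<tau> - \<sigma>) * u \<xi> * v \<xi> * (L - 0)"
    using mvt_simple[of 0 L w "\<lambda>x. (*) ((\<tau> - \<sigma>) * u x * v x)"] \<open>L > 0\<close>
    by (auto simp: has_field_derivative_def)
  have "w 0 = 0"
    using boundary_condition_wronskian_zero[of \<beta>\<^sub>0 "- deriv_on L u 0" "u 0" "- deriv_on L v 0" "v 0"] u v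
    by (simp add: w_def solves_bvp_def)
  moreover have "w L = 0"
    using boundary_condition_wronskian_zero[of \<beta>\<^sub>\<omega> "deriv_on L u L" "u L" "deriv_on L v L" "v L"] u v
    by (simp add: w_def solves_bvp_def)
  moreover have "u \<xi> > 0" "v \<xi> > 0"
    using u v \<xi>(1) by auto
  ultimately show ?thesis
    using \<xi>(2) \<open>L > 0\<close> by simp
qed

section \<open>Recognising the principal eigenvalue\<close>

lemma deriv_on_eqI:
  assumes "L > 0" "x \<in> {0..L}" "\<And>y. y \<in> {0..L} \<Longrightarrow> f y = g y"
    and "(g has_real_derivative d) (at x)"
  shows "deriv_on L f x = d"
proof -
  have "(g has_vector_derivative d) (at x within {0..L})"
    using assms(4) has_real_derivative_iff_has_vector_derivative has_vector_derivative_at_within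
    by blast
  then have "(f has_vector_derivative d) (at x within {0..L})"
    using assms(2,3) by (metis has_vector_derivative_transform)
  then show ?thesis
    using assms(1,2) by (simp add: deriv_on_def vector_derivative_within_closed_interval)
qed

text \<open>On a linear second-order equation smoothness is automatic: the span of \<open>u\<close> and \<open>u'\<close> is closed
  under differentiation, so every iterated derivative stays inside it.  The representation
  holds on \<open>[0,L]\<close> only, since the derivative relative to \<open>[0,L]\<close> is unspecified elsewhere.\<close>

lemma solves_bvpI:
  assumes "L > 0"
    and u: "\<And>x. (u has_real_derivative v x) (at x)"
    and v: "\<And>x. (v has_real_derivative - \<sigma> * u x) (at x)"
    and "boundary_condition \<beta>\<^sub>0 (- v 0) (u 0)" "boundary_condition \<beta>\<^sub>\<omega> (v L) (u L)"
  shows "solves_bvp \<beta>\<^sub>0 \<beta>\<^sub>\<omega> L \<sigma> u"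
proof -
  have span: "\<exists>c d. \<forall>x\<in>{0..L}. (deriv_on L ^^ n) u x = c * u x + d * v x" for n
  proof (induction n)
    case 0
    show ?case by (rule exI[of _ 1], rule exI[of _ 0]) simp
  next
    case (Suc n)
    then obtain c d where cd: "\<forall>x\<in>{0..L}. (deriv_on L ^^ n) u x = c * u x + d * v x"
      by blast
    have "deriv_on L ((deriv_on L ^^ n) u) x = - \<sigma> * d * u x + c * v x" if "x \<in> {0..L}" for x
    proof (rule deriv_on_eqI[OF \<open>L > 0\<close> that])
      show "((\<lambda>x. c * u x + d * v x) has_real_derivative - \<sigma> * d * u x + c * v x) (at x)"
        by (rule derivative_eq_intros u v refl)+ simp
    qed (use cd in auto)
    then show ?case
      by (intro exI[of _ "- \<sigma> * d"] exI[of _ c]) simp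
  qed
  have "(deriv_on L ^^ n) u differentiable_on {0..L}" for n
  proof -
    obtain c d where cd: "\<And>x. x \<in> {0..L} \<Longrightarrow> (deriv_on L ^^ n) u x = c * u x + d * v x"
      using span by blast
    have "u differentiable_on {0..L}" "v differentiable_on {0..L}"
      using u v by (meson differentiable_at_imp_differentiable_on real_differentiable_def)+
    then have "(\<lambda>x. c * u x + d * v x) differentiable_on {0..L}"
      by (intro differentiable_on_add differentiable_on_mult differentiable_on_const)
    then show ?thesis
      unfolding differentiable_on_def
      by (auto intro: differentiable_transform_within[OF _ zero_less_one] simp: cd)
  qed
  moreover have d1: "deriv_on L u x = v x" if "x \<in> {0..L}" for x
    by (rule deriv_on_eqI[OF \<open>L > 0\<close> that refl u])
  moreover have "deriv_on L (deriv_on L u) x = - \<sigma> * u x" if "x \<in> {0..L}" for x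
    by (rule deriv_on_eqI[OF \<open>L > 0\<close> that d1 v])
  ultimately show ?thesis
    using assms by (simp add: solves_bvp_def smooth_on_interval_def)
qed

lemma principal_eigenvalue_eqI:
  assumes "L > 0"
    and "\<And>x. (u has_real_derivative v x) (at x)"
    and "\<And>x. (v has_real_derivative - \<sigma> * u x) (at x)"
    and "boundary_condition \<beta>\<^sub>0 (- v 0) (u 0)" "boundary_condition \<beta>\<^sub>\<omega> (v L) (u L)"
    and "\<And>x. x \<in> {0<..<L} \<Longrightarrow> u x > 0"
  shows "principal_eigenvalue \<beta>\<^sub>0 \<beta>\<^sub>\<omega> L = \<sigma>"
  unfolding principal_eigenvalue_def
proof (rule the_equality)
  show sol: "\<exists>u. solves_bvp \<beta>\<^sub>0 \<beta>\<^sub>\<omega> L \<sigma> u \<and> (\<forall>x\<in>{0<..<L}. u x > 0)"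
    using solves_bvpI[OF assms(1-5)] assms(6) by blast
  show "\<tau> = \<sigma>" if "\<exists>u. solves_bvp \<beta>\<^sub>0 \<beta>\<^sub>\<omega> L \<tau> u \<and> (\<forall>x\<in>{0<..<L}. u x > 0)" for \<tau>
    using that sol solves_bvp_unique[OF \<open>L > 0\<close>] by blast
qed

section \<open>Positive sum: trigonometric eigenfunctions\<close>

text \<open>The phase at which \<open>cos\<close>, run at frequency \<open>k\<close> towards the boundary point, meets the boundary
  condition with parameter \<open>\<beta>\<close>; the Dirichlet value is the limit \<open>arctan \<infinity>\<close>.\<close>

definition robin_angle :: "ereal \<Rightarrow> real \<Rightarrow> real" where
  "robin_angle \<beta> k = (if \<beta> = \<infinity> then pi / 2 else arctan (real_of_ereal \<beta> / k))"

lemma robin_angle_bounds: "- (pi / 2) < robin_angle \<beta> k" "robin_angle \<beta> k \<le> pi / 2"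
  using arctan_bounded[of "real_of_ereal \<beta> / k"] by (auto simp: robin_angle_def)

lemma boundary_condition_robin_angle:
  assumes "k > 0"
  shows "boundary_condition \<beta> (- (k * sin (robin_angle \<beta> k))) (cos (robin_angle \<beta> k))"
proof (cases "\<beta> = \<infinity>")
  case False
  define t where "t = arctan (real_of_ereal \<beta> / k)"
  have "cos t \<noteq> 0" "tan t = real_of_ereal \<beta> / k"
    by (simp_all add: t_def tan_arctan)
  then have "k * sin t = real_of_ereal \<beta> * cos t"
    using assms by (simp add: tan_def field_simps)
  then show ?thesis
    using False by (simp add: boundary_condition_def robin_angle_def t_def)
qed (simp add: boundary_condition_def robin_angle_def)

lemma continuous_on_robin_angle: "continuous_on {0<..} (robin_angle \<beta>)"
  unfolding robin_angle_def by (cases "\<beta> = \<infinity>") (auto intro!: continuous_intros)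

lemma robin_angle_sum_pos:
  assumes "\<beta> \<noteq> -\<infinity>" "\<gamma> \<noteq> -\<infinity>" "\<beta> + \<gamma> > 0" "k > 0"
  shows "robin_angle \<beta> k + robin_angle \<gamma> k > 0"
proof (cases "\<beta> = \<infinity> \<or> \<gamma> = \<infinity>")
  case True
  then show ?thesis
    using robin_angle_bounds(1)[of \<beta> k] robin_angle_bounds(1)[of \<gamma> k]
    by (auto simp: robin_angle_def)
next
  case False
  then obtain b c where "\<beta> = ereal b" "\<gamma> = ereal c"
    using assms by (cases \<beta>; cases \<gamma>) auto
  moreover from this have "- c / k < b / k"
    using assms by (intro divide_strict_right_mono) auto
  then have "arctan (- (c / k)) < arctan (b / k)"
    by (subst arctan_less_iff) simp
  ultimately show ?thesis
    by (simp add: robin_angle_def arctan_minus)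
qed

lemma principal_eigenvalue_eq_square:
  assumes "L > 0" "k > 0" and root: "robin_angle \<beta>\<^sub>0 k + robin_angle \<beta>\<^sub>\<omega> k = k * L"
  shows "principal_eigenvalue \<beta>\<^sub>0 \<beta>\<^sub>\<omega> L = k\<^sup>2"
proof -
  define a where "a = robin_angle \<beta>\<^sub>0 k"
  have end_phase: "k * L - a = robin_angle \<beta>\<^sub>\<omega> k"
    using root by (simp add: a_def)
  show ?thesis
  proof (rule principal_eigenvalue_eqI[where u = "\<lambda>x. cos (k * x - a)"
        and v = "\<lambda>x. - (k * sin (k * x - a))"])
    fix x
    show "((\<lambda>x. cos (k * x - a)) has_real_derivative - (k * sin (k * x - a))) (at x)"
      by (auto intro!: derivative_eq_intros)
    show "((\<lambda>x. - (k * sin (k * x - a))) has_real_derivative - k\<^sup>2 * cos (k * x - a)) (at x)"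
      by (auto intro!: derivative_eq_intros simp: power2_eq_square)
  next
    show "boundary_condition \<beta>\<^sub>0 (- (- (k * sin (k * 0 - a)))) (cos (k * 0 - a))"
      using boundary_condition_robin_angle[OF \<open>k > 0\<close>, of \<beta>\<^sub>0] by (simp add: a_def)
    show "boundary_condition \<beta>\<^sub>\<omega> (- (k * sin (k * L - a))) (cos (k * L - a))"
      unfolding end_phase by (rule boundary_condition_robin_angle[OF \<open>k > 0\<close>])
  next
    fix x assume x: "x \<in> {0<..<L}"
    then have "0 < k * x" "k * x < k * L"
      using \<open>k > 0\<close> by auto
    then show "cos (k * x - a) > 0"
      using robin_angle_bounds[of \<beta>\<^sub>0 k] robin_angle_bounds[of \<beta>\<^sub>\<omega> k] end_phase
      by (intro cos_gt_zero_pi) (auto simp: a_def)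
  qed fact
qed

lemma principal_eigenvalue_at_top:
  assumes "\<beta>\<^sub>0 \<noteq> -\<infinity>" "\<beta>\<^sub>\<omega> \<noteq> -\<infinity>" "\<beta>\<^sub>0 + \<beta>\<^sub>\<omega> > 0"
  shows "filterlim (\<lambda>L. principal_eigenvalue \<beta>\<^sub>0 \<beta>\<^sub>\<omega> L) at_top (at_right 0)"
  unfolding filterlim_at_top
proof
  fix Z :: real
  define K where "K = 1 + \<bar>Z\<bar>"
  have "K \<ge> 1" by (simp add: K_def)
  define s where "s k = robin_angle \<beta>\<^sub>0 k + robin_angle \<beta>\<^sub>\<omega> k" for k
  have "s K > 0"
    using robin_angle_sum_pos assms \<open>K \<ge> 1\<close> by (simp add: s_def)
  then have "\<forall>\<^sub>F L in at_right 0. L < s K / K"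
    using \<open>K \<ge> 1\<close> by (intro eventually_at_rightI[of 0 "s K / K"]) auto
  moreover have "\<forall>\<^sub>F L in at_right (0::real). L > 0"
    by (rule eventually_at_right_less)
  ultimately show "\<forall>\<^sub>F L in at_right 0. Z \<le> principal_eigenvalue \<beta>\<^sub>0 \<beta>\<^sub>\<omega> L"
  proof eventually_elim
    case (elim L)
    \<comment> \<open>Both angles are at most \<open>\<pi>/2\<close>, so \<open>k L\<close> has caught up with their sum once \<open>k L \<ge> \<pi>\<close>.\<close>
    define M where "M = max K (pi / L)"
    have "s M \<le> pi"
      using robin_angle_bounds(2)[of \<beta>\<^sub>0 M] robin_angle_bounds(2)[of \<beta>\<^sub>\<omega> M] by (simp add: s_def)
    also have "pi / L \<le> M" by (simp add: M_def)
    then have "pi \<le> M * L" using elim by (simp add: field_simps)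
    finally have "s M - M * L \<le> 0" by simp
    moreover have "s K - K * L \<ge> 0"
      using elim \<open>K \<ge> 1\<close> by (simp add: field_simps)
    moreover have "continuous_on {K..M} (\<lambda>k. s k - k * L)"
      unfolding s_def using \<open>K \<ge> 1\<close>
      by (intro continuous_intros continuous_on_subset[OF continuous_on_robin_angle]) auto
    ultimately obtain k where k: "k \<ge> K" "s k - k * L = 0"
      using IVT2'[of "\<lambda>k. s k - k * L" M 0 K] by (auto simp: M_def)
    then have "principal_eigenvalue \<beta>\<^sub>0 \<beta>\<^sub>\<omega> L = k\<^sup>2"
      using \<open>K \<ge> 1\<close> elim by (intro principal_eigenvalue_eq_square) (auto simp: s_def)
    moreover have "k \<le> k\<^sup>2"
      using k \<open>K \<ge> 1\<close> by (intro self_le_power) auto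
    ultimately show ?case
      using k(1) by (simp add: K_def)
  qed
qed

section \<open>Zero sum: an exponential eigenfunction\<close>

lemma principal_eigenvalue_zero_sum:
  assumes "L > 0"
  shows "principal_eigenvalue (ereal b) (ereal (- b)) L = - b\<^sup>2"
proof (rule principal_eigenvalue_eqI[where u = "\<lambda>x. exp (b * x)" and v = "\<lambda>x. b * exp (b * x)"])
  fix x
  show "((\<lambda>x. exp (b * x)) has_real_derivative b * exp (b * x)) (at x)"
    by (auto intro!: derivative_eq_intros)
  show "((\<lambda>x. b * exp (b * x)) has_real_derivative - (- b\<^sup>2) * exp (b * x)) (at x)"
    by (auto intro!: derivative_eq_intros simp: power2_eq_square)
qed (use assms in \<open>auto simp: boundary_condition_def\<close>)

section \<open>Negative sum: hyperbolic eigenfunctions\<close>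

text \<open>The eigenfunction is \<open>2 (k cosh (k x) + b sinh (k x))\<close>, the solution with the initial data
  prescribed at \<open>0\<close>.  Written in exponentials it is visibly positive for \<open>k > \<bar>b\<bar>\<close>, which is no
  restriction here, as only large \<open>k\<close> matter.\<close>

lemma principal_eigenvalue_eq_minus_square:
  assumes "L > 0" "k > \<bar>b\<bar>"
    and root: "(k - b) * (k - c) = (k + b) * (k + c) * exp (2 * k * L)"
  shows "principal_eigenvalue (ereal b) (ereal c) L = - k\<^sup>2"
proof (rule principal_eigenvalue_eqI[where
      u = "\<lambda>x. (k + b) * exp (k * x) + (k - b) * exp (- (k * x))" and
      v = "\<lambda>x. k * ((k + b) * exp (k * x) - (k - b) * exp (- (k * x)))"])
  fix x
  show "((\<lambda>x. (k + b) * exp (k * x) + (k - b) * exp (- (k * x))) has_real_derivative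
      k * ((k + b) * exp (k * x) - (k - b) * exp (- (k * x)))) (at x)"
    by (auto intro!: derivative_eq_intros simp: algebra_simps)
  show "((\<lambda>x. k * ((k + b) * exp (k * x) - (k - b) * exp (- (k * x)))) has_real_derivative
      - (- k\<^sup>2) * ((k + b) * exp (k * x) + (k - b) * exp (- (k * x)))) (at x)"
    by (auto intro!: derivative_eq_intros simp: algebra_simps power2_eq_square)
next
  show "boundary_condition (ereal b)
      (- (k * ((k + b) * exp (k * 0) - (k - b) * exp (- (k * 0)))))
      ((k + b) * exp (k * 0) + (k - b) * exp (- (k * 0)))"
    by (simp add: boundary_condition_def algebra_simps)
  define e where "e = exp (k * L)"
  have e: "e * exp (- (k * L)) = 1" "exp (2 * k * L) = e * e"
    by (simp_all add: e_def flip: exp_add)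
  \<comment> \<open>The condition at \<open>L\<close> is the characteristic equation divided by \<open>exp (k L)\<close>.\<close>
  have "k * ((k + b) * e - (k - b) * exp (- (k * L))) + c * ((k + b) * e + (k - b) * exp (- (k * L)))
      = exp (- (k * L)) * ((k + b) * (k + c) * (e * e) - (k - b) * (k - c))"
    using e(1) by algebra
  also have "\<dots> = 0"
    using root e(2) by simp
  finally show "boundary_condition (ereal c)
      (k * ((k + b) * exp (k * L) - (k - b) * exp (- (k * L))))
      ((k + b) * exp (k * L) + (k - b) * exp (- (k * L)))"
    by (simp add: boundary_condition_def e_def)
next
  fix x
  show "(k + b) * exp (k * x) + (k - b) * exp (- (k * x)) > 0"
  proof -
    have "k + b > 0" "k - b > 0"
      using assms(2) by auto
    then show ?thesis
      by (simp add: add_pos_pos)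
  qed
qed fact

lemma principal_eigenvalue_at_bot:
  assumes "b + c < 0"
  shows "filterlim (\<lambda>L. principal_eigenvalue (ereal b) (ereal c) L) at_bot (at_right 0)"
  unfolding filterlim_at_bot
proof
  fix Z :: real
  define K where "K = 1 + \<bar>Z\<bar> + \<bar>b\<bar>"
  have K: "K \<ge> 1" "K > \<bar>b\<bar>" by (auto simp: K_def)
  define g where "g L k = (k - b) * (k - c) - (k + b) * (k + c) * exp (2 * k * L)" for L k
  have "((\<lambda>L. g L K) \<longlongrightarrow> g 0 K) (at_right 0)"
    unfolding g_def by (intro tendsto_intros)
  moreover have "g 0 K = - (2 * K * (b + c))"
    by (simp add: g_def algebra_simps)
  moreover have "K * (b + c) < 0"
    using assms K by (intro mult_pos_neg) auto
  \<comment> \<open>As \<open>L\<close> tends to \<open>0\<close> the exponential disappears, and the sign of \<open>b + c\<close> decides.\<close>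
  ultimately have "\<forall>\<^sub>F L in at_right 0. g L K > 0"
    by (intro order_tendstoD) auto
  moreover have "\<forall>\<^sub>F L in at_right (0::real). L > 0"
    by (rule eventually_at_right_less)
  ultimately show "\<forall>\<^sub>F L in at_right 0. principal_eigenvalue (ereal b) (ereal c) L \<le> Z"
  proof eventually_elim
    case (elim L)
    \<comment> \<open>For fixed \<open>L > 0\<close>, in contrast, the exponential dominates for large \<open>k\<close>.\<close>
    have "filterlim (g L) at_bot at_top"
      unfolding g_def using elim(2) by real_asymp
    then have "\<forall>\<^sub>F k in at_top. g L k \<le> 0 \<and> k \<ge> K"
      by (simp add: filterlim_at_bot eventually_conj eventually_ge_at_top)
    then obtain M where M: "g L M \<le> 0" "M \<ge> K"
      by (auto dest: eventually_happens)
    moreover have "continuous_on {K..M} (g L)"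
      unfolding g_def by (intro continuous_intros)
    ultimately obtain k where k: "k \<ge> K" "g L k = 0"
      using IVT2'[of "g L" M 0 K] elim by auto
    then have "principal_eigenvalue (ereal b) (ereal c) L = - k\<^sup>2"
      using K elim by (intro principal_eigenvalue_eq_minus_square) (auto simp: g_def)
    moreover have "k \<le> k\<^sup>2"
      using k K by (intro self_le_power) auto
    ultimately show ?case
      using k(1) by (simp add: K_def)
  qed
qed

section \<open>The limit of the principal eigenvalue on short intervals\<close>

theorem theorem1p1:
  fixes \<beta>\<^sub>0 \<beta>\<^sub>\<omega> :: ereal
  assumes "\<beta>\<^sub>0 \<noteq> -\<infinity>" and "\<beta>\<^sub>\<omega> \<noteq> -\<infinity>"
  shows "(\<beta>\<^sub>0 + \<beta>\<^sub>\<omega> > 0 \<longrightarrow>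
            filterlim (\<lambda>L. principal_eigenvalue \<beta>\<^sub>0 \<beta>\<^sub>\<omega> L) at_top (at_right 0)) \<and>
         (\<beta>\<^sub>0 + \<beta>\<^sub>\<omega> = 0 \<longrightarrow>
            (\<forall>L>0. principal_eigenvalue \<beta>\<^sub>0 \<beta>\<^sub>\<omega> L = - (real_of_ereal \<beta>\<^sub>0)\<^sup>2 \<and>
                   - (real_of_ereal \<beta>\<^sub>0)\<^sup>2 \<le> 0)) \<and>
         (\<beta>\<^sub>0 + \<beta>\<^sub>\<omega> < 0 \<longrightarrow>
            filterlim (\<lambda>L. principal_eigenvalue \<beta>\<^sub>0 \<beta>\<^sub>\<omega> L) at_bot (at_right 0))"
proof (intro conjI impI)
  assume "\<beta>\<^sub>0 + \<beta>\<^sub>\<omega> > 0"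
  then show "filterlim (\<lambda>L. principal_eigenvalue \<beta>\<^sub>0 \<beta>\<^sub>\<omega> L) at_top (at_right 0)"
    using assms by (intro principal_eigenvalue_at_top)
next
  assume sum: "\<beta>\<^sub>0 + \<beta>\<^sub>\<omega> = 0"
  then obtain b c where "\<beta>\<^sub>0 = ereal b" "\<beta>\<^sub>\<omega> = ereal c" "b + c = 0"
    using assms by (cases \<beta>\<^sub>0; cases \<beta>\<^sub>\<omega>) auto
  moreover from this have "c = - b" by simp
  ultimately show "\<forall>L>0. principal_eigenvalue \<beta>\<^sub>0 \<beta>\<^sub>\<omega> L = - (real_of_ereal \<beta>\<^sub>0)\<^sup>2 \<and>
      - (real_of_ereal \<beta>\<^sub>0)\<^sup>2 \<le> 0"
    using principal_eigenvalue_zero_sum by simp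
next
  assume "\<beta>\<^sub>0 + \<beta>\<^sub>\<omega> < 0"
  then obtain b c where "\<beta>\<^sub>0 = ereal b" "\<beta>\<^sub>\<omega> = ereal c" "b + c < 0"
    using assms by (cases \<beta>\<^sub>0; cases \<beta>\<^sub>\<omega>) auto
  then show "filterlim (\<lambda>L. principal_eigenvalue \<beta>\<^sub>0 \<beta>\<^sub>\<omega> L) at_bot (at_right 0)"
    using principal_eigenvalue_at_bot by simp
qed

end
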